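(* Let $R=\mathbb{F}_q$ be a finite field with $q$ elements, let $t\in\mathbb{F}_q^\times$, and let $d\geq 2$. Then $$\|A_t\|_2\leq\sqrt{2}\,q^{\frac{d-1}{2}}.$$
   Context: For $x,y\in\mathbb{F}_q^d$, $y\cdot x=y_1x_1+\dots+y_dx_d$. For $f:\mathbb{F}_q^d\to\mathbb{C}$, $\|f\|_2=\left(\sum_{x}|f(x)|^2\right)^{1/2}$. Let $W$ be the space of mean-zero functions $f:\mathbb{F}_q^d\to\mathbb{C}$ (those with $\sum_x f(x)=0$) and $V$ the space of all functions $\mathbb{F}_q^d\to\mathbb{C}$. $A_t:W\to V$ is the operator $A_tf(x)=\sum_{y:\,y\cdot x=t}f(y)$, and $\|A_t\|_2$ is its operator norm with respect to the $L^2$ norms, i.e. the least $K$ with $\|A_tf\|_2\leq K\|f\|_2$ for all $f\in W$. *)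

theory Defs
  imports "HOL-Analysis.Analysis"
begin

definition l2_norm :: "('b::finite \<Rightarrow> complex) \<Rightarrow> real" where
  "l2_norm f = L2_set (\<lambda>x. cmod (f x)) UNIV"

definition mean_zero :: "('b::finite \<Rightarrow> complex) set" where
  "mean_zero = {f. (\<Sum>x\<in>UNIV. f x) = 0}"

text \<open>The operator on all functions; its domain is cut down to the mean-zero functions
  when the norm is taken.\<close>

definition A_op :: "'a::{field,finite} \<Rightarrow> ('a ^ 'n \<Rightarrow> complex) \<Rightarrow> ('a ^ 'n \<Rightarrow> complex)" where
  "A_op t f = (\<lambda>x. \<Sum>y\<in>{y. scalar_product y x = t}. f y)"

text \<open>Norm of \<open>T\<close> as an operator with domain \<open>W\<close>. The library's \<open>onorm\<close> does not
  apply, because it has no argument for the domain. A least \<open>K\<close> need not exist for arbitrary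
  \<open>W\<close> and \<open>T\<close>; \<open>A_op_norm_is_least\<close> below shows that it does for \<open>A_op t\<close> on \<open>mean_zero\<close>.\<close>

definition l2_op_norm :: "('b::finite \<Rightarrow> complex) set
    \<Rightarrow> (('b \<Rightarrow> complex) \<Rightarrow> ('c::finite \<Rightarrow> complex)) \<Rightarrow> real" where
  "l2_op_norm W T = (LEAST K. \<forall>f\<in>W. l2_norm (T f) \<le> K * l2_norm f)"

lemma l2_op_norm_is_least:
  assumes W: "g \<in> W" "l2_norm g > 0"
    and C: "\<And>f. f \<in> W \<Longrightarrow> l2_norm (T f) \<le> C * l2_norm f"
  shows "f \<in> W \<Longrightarrow> l2_norm (T f) \<le> l2_op_norm W T * l2_norm f"
    and "(\<And>f. f \<in> W \<Longrightarrow> l2_norm (T f) \<le> K * l2_norm f) \<Longrightarrow> l2_op_norm W T \<le> K"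
proof -
  define S where "S = {K. \<forall>f\<in>W. l2_norm (T f) \<le> K * l2_norm f}"
  have lb: "0 \<le> k" if "k \<in> S" for k
  proof -
    have "0 \<le> l2_norm (T g)" by (simp add: l2_norm_def)
    also have "\<dots> \<le> k * l2_norm g" using that W by (auto simp: S_def)
    finally show ?thesis using W(2) by (simp add: zero_le_mult_iff)
  qed
  have ne: "S \<noteq> {}" using C by (auto simp: S_def)
  have bdd: "bdd_below S" by (rule bdd_belowI[of _ 0]) (rule lb)
  have "S = (\<Inter>f\<in>W. {K. l2_norm (T f) \<le> K * l2_norm f})" by (auto simp: S_def)
  also have "closed \<dots>" by (intro closed_INT ballI closed_Collect_le continuous_intros)
  finally have "closed S" .
  have mem: "Inf S \<in> S" using ne bdd \<open>closed S\<close> by (rule closed_contains_Inf)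
  have low: "Inf S \<le> k" if "k \<in> S" for k using that bdd by (rule cInf_lower)
  have eq: "l2_op_norm W T = Inf S"
    unfolding l2_op_norm_def using mem low by (intro Least_equality) (auto simp: S_def)
  show "f \<in> W \<Longrightarrow> l2_norm (T f) \<le> l2_op_norm W T * l2_norm f"
    using mem unfolding eq by (auto simp: S_def)
  show "(\<And>f. f \<in> W \<Longrightarrow> l2_norm (T f) \<le> K * l2_norm f) \<Longrightarrow> l2_op_norm W T \<le> K"
    unfolding eq by (rule low) (auto simp: S_def)
qed

lemma A_op_norm_is_least:
  fixes t :: "'a::{field,finite}" and f :: "'a ^ 'n \<Rightarrow> complex"
  defines "N \<equiv> l2_op_norm mean_zero (A_op t :: ('a ^ 'n \<Rightarrow> complex) \<Rightarrow> _)"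
  shows "f \<in> mean_zero \<Longrightarrow> l2_norm (A_op t f) \<le> N * l2_norm f"
    and "(\<And>f :: 'a ^ 'n \<Rightarrow> complex. f \<in> mean_zero \<Longrightarrow> l2_norm (A_op t f) \<le> K * l2_norm f)
      \<Longrightarrow> N \<le> K"
proof -
  define g :: "'a ^ 'n \<Rightarrow> complex"
    where "g x = (if x = 0 then 1 else if x = 1 then -1 else 0)" for x
  have "(0 :: 'a ^ 'n) \<noteq> 1" by (simp add: vec_eq_iff)
  then have "(\<Sum>x\<in>UNIV. g x) = (\<Sum>x\<in>{0,1}. g x)"
    by (intro sum.mono_neutral_right) (auto simp: g_def)
  also have "\<dots> = 0" using \<open>(0 :: 'a ^ 'n) \<noteq> 1\<close> by (simp add: g_def)
  finally have g: "g \<in> mean_zero" by (simp add: mean_zero_def)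
  have "cmod (g 0) \<le> l2_norm g"
    unfolding l2_norm_def by (rule member_le_L2_set) auto
  then have g0: "l2_norm g > 0" by (simp add: g_def)
  have C: "l2_norm (A_op t f) \<le> (real CARD('a ^ 'n) * real CARD('a ^ 'n)) * l2_norm f"
    for f :: "'a ^ 'n \<Rightarrow> complex"
  proof -
    have 1: "cmod (A_op t f x) \<le> real CARD('a ^ 'n) * l2_norm f" for x
    proof -
      have "cmod (A_op t f x) \<le> (\<Sum>y\<in>{y. scalar_product y x = t}. cmod (f y))"
        unfolding A_op_def by (rule norm_sum)
      also have "\<dots> \<le> (\<Sum>y\<in>UNIV. cmod (f y))" by (rule sum_mono2) auto
      also have "\<dots> \<le> (\<Sum>y\<in>(UNIV :: ('a ^ 'n) set). l2_norm f)"
        unfolding l2_norm_def by (intro sum_mono member_le_L2_set) auto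
      finally show ?thesis by simp
    qed
    have "l2_norm (A_op t f) \<le> (\<Sum>x\<in>UNIV. cmod (A_op t f x))"
      unfolding l2_norm_def by (rule L2_set_le_sum) auto
    also have "\<dots> \<le> (\<Sum>x\<in>(UNIV :: ('a ^ 'n) set). real CARD('a ^ 'n) * l2_norm f)"
      by (intro sum_mono 1)
    finally show ?thesis by simp
  qed
  show "f \<in> mean_zero \<Longrightarrow> l2_norm (A_op t f) \<le> N * l2_norm f"
    unfolding N_def by (rule l2_op_norm_is_least(1)[OF g g0 C])
  show "(\<And>f :: 'a ^ 'n \<Rightarrow> complex. f \<in> mean_zero \<Longrightarrow> l2_norm (A_op t f) \<le> K * l2_norm f)
      \<Longrightarrow> N \<le> K"
    unfolding N_def by (rule l2_op_norm_is_least(2)[OF g g0 C])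
qed

end

theory Submission
  imports Defs
begin

text \<open>
  Write \<open>q\<close> for the size of the field and \<open>d\<close> for the dimension. Estimating one operator
  \<open>A_op t\<close> by its second moment would call for the number of common solutions of
  \<open>y \<bullet> x = t\<close> and \<open>z \<bullet> x = t\<close>, which depends on how \<open>y\<close> and \<open>z\<close> are related. Averaging over
  \<open>t\<close> avoids this: the squares \<open>\<parallel>A_op s f\<parallel>\<^sup>2\<close>, added over all \<open>s\<close> in the field, involve only
  the solutions of \<open>y \<bullet> x = z \<bullet> x\<close>, a hyperplane with \<open>q ^ (d - 1)\<close> points when \<open>y \<noteq> z\<close> and
  the whole space when \<open>y = z\<close>. If \<open>f\<close> has mean zero, the constant part of this count
  contributes nothing and the total is \<open>(q ^ d - q ^ (d - 1)) \<parallel>f\<parallel>\<^sup>2\<close>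
  (\<open>sum_l2_norm_A_op\<close>).

  The \<open>q - 1\<close> terms with \<open>s \<noteq> 0\<close> are all equal, because \<open>x \<mapsto> c x\<close> permutes the space and
  carries \<open>A_op t f\<close> to \<open>A_op (c t) f\<close> (\<open>l2_norm_A_op_scale\<close>). Dropping the nonnegative term
  \<open>s = 0\<close> and dividing by \<open>q - 1\<close> leaves \<open>\<parallel>A_op t f\<parallel>\<^sup>2 \<le> q ^ (d - 1) \<parallel>f\<parallel>\<^sup>2\<close>, which is stronger
  than the theorem by the factor \<open>sqrt 2\<close>.
\<close>

lemma l2_norm_power2: "(l2_norm f)\<^sup>2 = (\<Sum>x\<in>UNIV. (cmod (f x))\<^sup>2)"
  by (simp add: l2_norm_def L2_set_def sum_nonneg)

lemma scalar_product_add_right: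
  "scalar_product w (x + y) = scalar_product w x + scalar_product w (y :: 'a::comm_ring_1 ^ 'n)"
  by (simp add: scalar_product_def sum.distrib distrib_left)

lemma scalar_product_diff_right:
  "scalar_product w (x - y) = scalar_product w x - scalar_product w (y :: 'a::comm_ring_1 ^ 'n)"
  by (simp add: scalar_product_def sum_subtractf right_diff_distrib)

lemma scalar_product_diff_left:
  "scalar_product (y - z) x = scalar_product y x - scalar_product z (x :: 'a::comm_ring_1 ^ 'n)"
  by (simp add: scalar_product_def sum_subtractf left_diff_distrib)

lemma scalar_product_scale_right:
  "scalar_product y (c *s x) = c * scalar_product y (x :: 'a::comm_ring_1 ^ 'n)"
  by (simp add: scalar_product_def sum_distrib_left mult.left_commute)

lemma scalar_product_surj:
  fixes w :: "'a::field ^ 'n"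
  assumes "w \<noteq> 0"
  obtains v where "scalar_product w v = s"
proof -
  obtain i where i: "w $ i \<noteq> 0" using assms by (auto simp: vec_eq_iff)
  have "scalar_product w (axis i (s / w $ i)) = (\<Sum>j\<in>UNIV. if j = i then s else 0)"
    unfolding scalar_product_def using i by (intro sum.cong) (auto simp: axis_def)
  then show ?thesis by (intro that) simp
qed

text \<open>The level sets of \<open>x \<mapsto> w \<bullet> x\<close> are translates of one another, so the \<open>q\<close> of them share
  the \<open>q ^ d\<close> points equally.\<close>

lemma card_hyperplane:
  fixes w :: "'a::{field,finite} ^ 'n"
  assumes "w \<noteq> 0"
  shows "card {x. scalar_product w x = 0} = CARD('a) ^ (CARD('n) - 1)"
proof -
  have fib: "card {x. scalar_product w x = s} = card {x. scalar_product w x = 0}" for s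
  proof -
    obtain v where v: "scalar_product w v = s" using scalar_product_surj[OF assms] .
    have "bij_betw (\<lambda>x. x + v) {x. scalar_product w x = 0} {x. scalar_product w x = s}"
      by (rule bij_betw_byWitness[where f' = "\<lambda>x. x - v"])
        (auto simp: scalar_product_add_right scalar_product_diff_right v)
    then show ?thesis by (simp add: bij_betw_same_card)
  qed
  have "CARD('a ^ 'n) = card (\<Union>s\<in>UNIV. {x. scalar_product w x = s})"
    by (rule arg_cong[of _ _ card]) auto
  also have "\<dots> = (\<Sum>s\<in>UNIV. card {x. scalar_product w x = s})"
    by (rule card_UN_disjoint) auto
  also have "\<dots> = CARD('a) * card {x. scalar_product w x = 0}"
    by (subst sum.cong[OF refl fib]) simp_all
  finally have "CARD('a) * CARD('a) ^ (CARD('n) - 1) = CARD('a) * card {x. scalar_product w x = 0}"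
    using power_minus_mult[of "CARD('n)" "CARD('a)"] by (simp add: mult.commute)
  then show ?thesis by simp
qed

lemma sum_rotate:
  "(\<Sum>x\<in>A. \<Sum>y\<in>B. \<Sum>z\<in>C. g x y z) = (\<Sum>y\<in>B. \<Sum>z\<in>C. \<Sum>x\<in>A. g x y z)"
  by (subst sum.swap[of _ B A]) (intro sum.cong refl sum.swap)

text \<open>Expanding the square at a point \<open>x\<close> and adding over \<open>s\<close> keeps exactly the pairs
  \<open>(y, z)\<close> with \<open>y \<bullet> x = z \<bullet> x\<close>, without reference to their common value.\<close>

lemma sum_cmod_A_op:
  fixes f :: "'a::{field,finite} ^ 'n \<Rightarrow> complex"
  shows "(\<Sum>s\<in>UNIV. complex_of_real ((cmod (A_op s f x))\<^sup>2))
    = (\<Sum>y\<in>UNIV. \<Sum>z\<in>UNIV. of_bool (scalar_product y x = scalar_product z x) * (f y * cnj (f z)))"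
proof -
  have A: "A_op s f x = (\<Sum>y\<in>UNIV. of_bool (scalar_product y x = s) * f y)" for s
    unfolding A_op_def by (intro sum.mono_neutral_cong_left) auto
  have "(\<Sum>s\<in>UNIV. complex_of_real ((cmod (A_op s f x))\<^sup>2))
    = (\<Sum>s\<in>UNIV. \<Sum>y\<in>UNIV. \<Sum>z\<in>UNIV.
        of_bool (scalar_product y x = s) * of_bool (scalar_product z x = s) * (f y * cnj (f z)))"
    unfolding complex_norm_square A cnj_sum sum_product
    by (intro sum.cong refl) simp
  also have "\<dots> = (\<Sum>y\<in>UNIV. \<Sum>z\<in>UNIV. \<Sum>s\<in>UNIV.
        of_bool (scalar_product y x = s) * of_bool (scalar_product z x = s) * (f y * cnj (f z)))"
    by (rule sum_rotate)
  also have "\<dots> = (\<Sum>y\<in>UNIV. \<Sum>z\<in>UNIV.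
      of_bool (scalar_product y x = scalar_product z x) * (f y * cnj (f z)))"
  proof (intro sum.cong refl)
    fix y z
    have "(\<Sum>s\<in>UNIV. of_bool (scalar_product y x = s) * of_bool (scalar_product z x = s)
          * (f y * cnj (f z)))
      = (\<Sum>s\<in>UNIV. if s = scalar_product y x
          then of_bool (scalar_product y x = scalar_product z x) * (f y * cnj (f z)) else 0)"
      by (intro sum.cong) auto
    then show "(\<Sum>s\<in>UNIV. of_bool (scalar_product y x = s) * of_bool (scalar_product z x = s)
          * (f y * cnj (f z)))
      = of_bool (scalar_product y x = scalar_product z x) * (f y * cnj (f z))"
      by simp
  qed
  finally show ?thesis .
qed

text \<open>After summation over \<open>x\<close> the coefficient of \<open>f y * cnj (f z)\<close> is a constant plus a multiple
  of the identity matrix. The constant contributes a multiple of \<open>\<bar>\<Sum>y. f y\<bar>\<^sup>2 = 0\<close>.\<close>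

lemma sum_l2_norm_A_op:
  fixes f :: "'a::{field,finite} ^ 'n \<Rightarrow> complex"
  assumes "f \<in> mean_zero"
  shows "(\<Sum>s\<in>UNIV. (l2_norm (A_op s f))\<^sup>2)
    = (real CARD('a) - 1) * real CARD('a) ^ (CARD('n) - 1) * (l2_norm f)\<^sup>2"
proof -
  define k where "k = real CARD('a) ^ (CARD('n) - 1)"
  \<comment> \<open>How many more solutions \<open>y \<bullet> x = z \<bullet> x\<close> has for \<open>y = z\<close> than for \<open>y \<noteq> z\<close>.\<close>
  define D where "D = (real CARD('a) - 1) * k"
  have qk: "real CARD('a) ^ CARD('n) = k + D"
    using power_minus_mult[of "CARD('n)" "real CARD('a)"]
    by (simp add: k_def D_def algebra_simps)
  have count: "(\<Sum>x\<in>UNIV. of_bool (scalar_product y x = scalar_product z x))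
      = complex_of_real k + of_bool (y = z) * complex_of_real D" for y z :: "'a ^ 'n"
  proof -
    have "(\<Sum>x\<in>UNIV. of_bool (scalar_product y x = scalar_product z x))
        = complex_of_real (real (card {x. scalar_product (y - z) x = 0}))"
      by (simp add: scalar_product_diff_left)
    also have "\<dots> = complex_of_real k + of_bool (y = z) * complex_of_real D"
    proof (cases "y = z")
      case True
      then show ?thesis using arg_cong[OF qk, of complex_of_real] by (simp add: scalar_product_def)
    next
      case False
      then show ?thesis by (simp add: card_hyperplane k_def)
    qed
    finally show ?thesis .
  qed
  have "complex_of_real (\<Sum>s\<in>UNIV. (l2_norm (A_op s f))\<^sup>2)
    = (\<Sum>x\<in>UNIV. \<Sum>s\<in>UNIV. complex_of_real ((cmod (A_op s f x))\<^sup>2))"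
    unfolding l2_norm_power2 of_real_sum by (rule sum.swap)
  also have "\<dots> = (\<Sum>x\<in>UNIV. \<Sum>y\<in>UNIV. \<Sum>z\<in>UNIV.
      of_bool (scalar_product y x = scalar_product z x) * (f y * cnj (f z)))"
    by (simp only: sum_cmod_A_op)
  also have "\<dots> = (\<Sum>y\<in>UNIV. \<Sum>z\<in>UNIV. \<Sum>x\<in>UNIV.
      of_bool (scalar_product y x = scalar_product z x) * (f y * cnj (f z)))"
    by (rule sum_rotate)
  also have "\<dots> = (\<Sum>y\<in>UNIV. \<Sum>z\<in>UNIV.
      (complex_of_real k + of_bool (y = z) * complex_of_real D) * (f y * cnj (f z)))"
    by (simp only: count flip: sum_distrib_right)
  also have "\<dots> = (\<Sum>y\<in>UNIV. \<Sum>z\<in>UNIV. complex_of_real k * (f y * cnj (f z)))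
      + (\<Sum>y\<in>UNIV. \<Sum>z\<in>UNIV. if z = y then complex_of_real D * (f y * cnj (f y)) else 0)"
    unfolding sum.distrib[symmetric] by (intro sum.cong refl) (auto simp: distrib_right)
  also have "(\<Sum>y\<in>UNIV. \<Sum>z\<in>UNIV. complex_of_real k * (f y * cnj (f z)))
      = complex_of_real k * ((\<Sum>y\<in>UNIV. f y) * cnj (\<Sum>z\<in>UNIV. f z))"
    unfolding cnj_sum sum_product by (simp only: sum_distrib_left)
  also have "\<dots> = 0" using assms by (simp add: mean_zero_def)
  also have "(\<Sum>y\<in>UNIV. \<Sum>z\<in>UNIV. if z = y then complex_of_real D * (f y * cnj (f y)) else 0)
      = complex_of_real (D * (l2_norm f)\<^sup>2)"
    unfolding complex_norm_square[symmetric]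
    by (simp add: l2_norm_power2 sum_distrib_left)
  finally have "complex_of_real (\<Sum>s\<in>UNIV. (l2_norm (A_op s f))\<^sup>2)
      = complex_of_real (D * (l2_norm f)\<^sup>2)" by simp
  then show ?thesis unfolding of_real_eq_iff by (simp add: D_def k_def)
qed

text \<open>For \<open>c \<noteq> 0\<close> the equations \<open>y \<bullet> (c x) = c t\<close> and \<open>y \<bullet> x = t\<close> have the same solutions \<open>y\<close>,
  so the two functions have the same values up to a permutation of the points.\<close>

lemma l2_norm_A_op_scale:
  fixes f :: "'a::{field,finite} ^ 'n \<Rightarrow> complex"
  assumes "c \<noteq> 0"
  shows "l2_norm (A_op (c * t) f) = l2_norm (A_op t f)"
proof -
  have "bij_betw (\<lambda>x :: 'a ^ 'n. c *s x) UNIV UNIV"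
    using assms
    by (intro bij_betw_byWitness[where f' = "\<lambda>x. inverse c *s x"])
      (auto simp: vector_smult_assoc)
  then have "(\<Sum>x\<in>UNIV. (cmod (A_op (c * t) f x))\<^sup>2)
      = (\<Sum>x\<in>UNIV. (cmod (A_op (c * t) f (c *s x)))\<^sup>2)"
    by (rule sum.reindex_bij_betw[symmetric])
  also have "\<dots> = (\<Sum>x\<in>UNIV. (cmod (A_op t f x))\<^sup>2)"
    using assms by (simp add: A_op_def scalar_product_scale_right)
  finally show ?thesis by (simp add: l2_norm_def L2_set_def)
qed

lemma l2_norm_A_op_le:
  fixes f :: "'a::{field,finite} ^ 'n \<Rightarrow> complex"
  assumes t: "t \<noteq> 0" and f: "f \<in> mean_zero"
  shows "(l2_norm (A_op t f))\<^sup>2 \<le> real CARD('a) ^ (CARD('n) - 1) * (l2_norm f)\<^sup>2"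
proof -
  have "l2_norm (A_op s f) = l2_norm (A_op t f)" if "s \<noteq> 0" for s
    using l2_norm_A_op_scale[of "s / t" t f] t that by simp
  then have "(\<Sum>s\<in>UNIV - {0}. (l2_norm (A_op s f))\<^sup>2)
      = (\<Sum>s\<in>UNIV - {0 :: 'a}. (l2_norm (A_op t f))\<^sup>2)"
    by (intro sum.cong) auto
  also have "\<dots> = (real CARD('a) - 1) * (l2_norm (A_op t f))\<^sup>2"
    by (simp add: card_Diff_singleton of_nat_diff Suc_leI)
  finally have "(real CARD('a) - 1) * (l2_norm (A_op t f))\<^sup>2
      = (\<Sum>s\<in>UNIV - {0}. (l2_norm (A_op s f))\<^sup>2)" ..
  also have "\<dots> \<le> (\<Sum>s\<in>UNIV. (l2_norm (A_op s f))\<^sup>2)"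
    by (rule sum_mono2) auto
  also have "\<dots> = (real CARD('a) - 1) * (real CARD('a) ^ (CARD('n) - 1) * (l2_norm f)\<^sup>2)"
    using sum_l2_norm_A_op[OF f] by simp
  finally have le: "(real CARD('a) - 1) * (l2_norm (A_op t f))\<^sup>2
      \<le> (real CARD('a) - 1) * (real CARD('a) ^ (CARD('n) - 1) * (l2_norm f)\<^sup>2)" .
  have "card {0, 1 :: 'a} \<le> CARD('a)" by (rule card_mono) auto
  then have "real CARD('a) - 1 > 0" by simp
  with le show ?thesis by (simp only: mult_le_cancel_left_pos)
qed

theorem theorem2p3:
  fixes t :: "'a::{field,finite}"
  assumes "t \<noteq> 0" and "CARD('n::finite) \<ge> 2"
  shows "l2_op_norm mean_zero (A_op t :: ('a ^ 'n \<Rightarrow> complex) \<Rightarrow> ('a ^ 'n \<Rightarrow> complex))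
    \<le> sqrt 2 * real CARD('a) powr ((real CARD('n) - 1) / 2)"
proof (rule A_op_norm_is_least(2))
  fix f :: "'a ^ 'n \<Rightarrow> complex"
  assume f: "f \<in> mean_zero"
  define K where "K = real CARD('a) powr ((real CARD('n) - 1) / 2)"
  have K0: "K \<ge> 0" by (simp add: K_def)
  have "K\<^sup>2 = real CARD('a) powr real (CARD('n) - 1)"
    using assms(2) by (simp add: K_def power2_eq_square of_nat_diff flip: powr_add)
  also have "\<dots> = real CARD('a) ^ (CARD('n) - 1)"
    by (rule powr_realpow) simp
  finally have "K\<^sup>2 = real CARD('a) ^ (CARD('n) - 1)" .
  then have "(l2_norm (A_op t f))\<^sup>2 \<le> (K * l2_norm f)\<^sup>2"
    using l2_norm_A_op_le[OF assms(1) f] by (simp only: power_mult_distrib)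
  then have "l2_norm (A_op t f) \<le> 1 * (K * l2_norm f)"
    unfolding mult_1 by (rule power2_le_imp_le) (simp add: K0 l2_norm_def)
  also have "\<dots> \<le> sqrt 2 * (K * l2_norm f)"
    using K0 by (intro mult_right_mono) (auto simp: l2_norm_def)
  finally show "l2_norm (A_op t f)
      \<le> sqrt 2 * real CARD('a) powr ((real CARD('n) - 1) / 2) * l2_norm f"
    by (simp add: K_def mult.assoc)
qed

end
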